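(* There exist a constant $c>0$, an instance space $\mathcal{X}$, and a family $\mathcal{F}$ of partial concept classes $\mathcal{C}\subseteq\{0,1,\star\}^{\mathcal{X}}$, each of Littlestone dimension $1$, such that for every $T\ge1$ every (possibly randomized) online learning algorithm $\mathcal{A}$ in the realizable setting that accesses the unknown class $\mathcal{C}\in\mathcal{F}$ through the ERM oracle and makes a finite number of queries has worst-case expected number of mistakes $M(\mathcal{A},T)\ge cT$, i.e. $\Omega(T)$ mistakes.
   Context: Partial concepts. A partial concept is a function $c:\mathcal{X}\to\{0,1,\star\}$; $c(x)=\star$ means $c$ is undefined at $x$, and $\mathrm{supp}(c)=\{x: c(x)\ne\star\}$. A finite sequence (or set) of pairs $(x_i,y_i)\in\mathcal{X}\times\{0,1\}$ is realizable by a partial concept class $\mathcal{C}\subseteq\{0,1,\star\}^{\mathcal{X}}$ if some $c\in\mathcal{C}$ has $c(x_i)=y_i$ for all $i$ (in particular all $x_i\in\mathrm{supp}(c)$); such $c$ is called consistent with it. The Littlestone dimension of $\mathcal{C}$ is the largest depth $n$ of a complete binary tree with internal nodes labeled by points of $\mathcal{X}$ such that for every root-to-leaf path, with edge labels $y_1,\dots,y_n\in\{0,1\}$ and visited nodes $x_1,\dots,x_n$, some $c\in\mathcal{C}$ has $c(x_i)=y_i$ for all $i$. Online learning with oracle access. The learner knows $\mathcal{X}$, $\mathcal{F}$ and the horizon $T$. An oblivious adversary fixes in advance an unknown class $\mathcal{C}\in\mathcal{F}$ and a sequence $(x_1,y_1),\dots,(x_T,y_T)\in\mathcal{X}\times\{0,1\}$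 realizable by $\mathcal{C}$. The learner accesses $\mathcal{C}$ only through an oracle. In round $t$: the learner observes $x_t$, may make oracle queries, picks a distribution on $\{0,1\}$ and predicts $\hat y_t$ drawn from it; then $y_t$ is revealed. $M(\mathcal{A},T)$ is the supremum, over $\mathcal{C}\in\mathcal{F}$ and over sequences realizable by $\mathcal{C}$, of the expected value (over the learner's randomness) of $\sum_{t=1}^T\mathbb{I}[\hat y_t\neq y_t]$. ERM oracle: given any finite $S\subset\mathcal{X}\times\{0,1\}$, if $S$ is realizable by $\mathcal{C}$ it returns some $c\in\mathcal{C}$ consistent with $S$; otherwise it returns "not realizable". When several answers are valid the choice may be made adversarially, i.e. worst-case quantities are also worst case over valid oracles. *)

theory Defs
  imports "HOL-Probability.Probability" "HOL-Library.Tree" "HOL-Library.FSet"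
    "HOL-Library.Extended_Nat"
begin

section \<open>Partial concepts\<close>

text \<open>The labels 0 and 1 are \<^const>\<open>False\<close> and \<^const>\<open>True\<close>. A partial concept is a partial
  function; \<^const>\<open>None\<close> plays the role of the undefined value \<open>\<star>\<close>, so \<^const>\<open>dom\<close> is the support.\<close>

type_synonym 'x concept = "'x \<Rightarrow> bool option"

definition partial_concepts :: "'x set \<Rightarrow> 'x concept set" where
  "partial_concepts X = {c. dom c \<subseteq> X}"

definition consistent :: "'x concept \<Rightarrow> ('x \<times> bool) set \<Rightarrow> bool" where
  "consistent c S \<longleftrightarrow> (\<forall>(x, y)\<in>S. c x = Some y)"

definition realizable :: "'x concept set \<Rightarrow> ('x \<times> bool) set \<Rightarrow> bool" where
  "realizable C S \<longleftrightarrow> (\<exists>c\<in>C. consistent c S)"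

section \<open>Littlestone dimension\<close>

fun root_to_leaf_paths :: "'x tree \<Rightarrow> ('x \<times> bool) list set" where
  "root_to_leaf_paths \<langle>\<rangle> = {[]}"
| "root_to_leaf_paths \<langle>l, x, r\<rangle> =
     (#) (x, False) ` root_to_leaf_paths l \<union> (#) (x, True) ` root_to_leaf_paths r"

definition shattered_tree :: "'x concept set \<Rightarrow> 'x tree \<Rightarrow> bool" where
  "shattered_tree C t \<longleftrightarrow> complete t \<and> (\<forall>p\<in>root_to_leaf_paths t. realizable C (set p))"

text \<open>The empty class shatters no tree at all and gets dimension 0 here.\<close>

definition littlestone_dim :: "'x concept set \<Rightarrow> enat" where
  "littlestone_dim C = (SUP t\<in>{t. shattered_tree C t}. enat (height t))"

section \<open>ERM oracles\<close>

text \<open>The answer \<^const>\<open>None\<close> means ``not realizable''; otherwise the learner receives the whole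
  concept. Oracles are fixed before the interaction starts: an answer depends on the query only.\<close>

type_synonym 'x answerer = "('x \<times> bool) fset \<Rightarrow> 'x concept option"

definition erm_oracle :: "'x concept set \<Rightarrow> 'x answerer \<Rightarrow> bool" where
  "erm_oracle C Orc \<longleftrightarrow> (\<forall>S.
     if realizable C (fset S) then \<exists>c\<in>C. consistent c (fset S) \<and> Orc S = Some c
     else Orc S = None)"

section \<open>Randomized online learners\<close>

text \<open>Everything the learner has seen and done so far, in chronological order. A prediction is
  recorded with the distribution that was picked and the label drawn from it.\<close>

datatype 'x event =
    Point 'x
  | Answer "('x \<times> bool) fset" "'x concept option"
  | Predicted "bool pmf" bool
  | Label bool

datatype 'x action =
    Query "('x \<times> bool) fset"
  | Predict "bool pmf"

text \<open>A learner chooses its next action at random, depending on the full history. Since the history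
  contains all its earlier random choices, this also covers learners that keep private random
  state: when \<open>'x\<close> is countable, there are only countably many queries and labels, so discrete
  distributions suffice and the choice can be made conditionally on the history. Knowledge of the
  instance space, of the family and of the horizon is implicit, as a learner is chosen after
  them.\<close>

type_synonym 'x learner = "'x event list \<Rightarrow> 'x action pmf"

text \<open>The part of a round between the arrival of the point and the draw of the prediction. Mass
  missing from the resulting sub-distribution is the probability of querying forever.\<close>

partial_function (spmf) query_phase ::
    "'x learner \<Rightarrow> 'x answerer \<Rightarrow> 'x event list \<Rightarrow> ('x event list \<times> bool pmf) spmf" where
  "query_phase A Orc h = bind_spmf (spmf_of_pmf (A h)) (\<lambda>a. case a of
       Query S \<Rightarrow> query_phase A Orc (h @ [Answer S (Orc S)])
     | Predict p \<Rightarrow> return_spmf (h, p))"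

text \<open>The number of mistakes on the remaining sequence, starting from history \<open>h\<close>.\<close>

fun mistakes_from ::
    "'x learner \<Rightarrow> 'x answerer \<Rightarrow> ('x \<times> bool) list \<Rightarrow> 'x event list \<Rightarrow> nat spmf" where
  "mistakes_from A Orc [] h = return_spmf 0"
| "mistakes_from A Orc ((x, y) # xys) h =
     bind_spmf (query_phase A Orc (h @ [Point x])) (\<lambda>(h', p).
     bind_spmf (spmf_of_pmf p) (\<lambda>b.
     map_spmf (\<lambda>m. of_bool (b \<noteq> y) + m)
       (mistakes_from A Orc xys (h' @ [Predicted p b, Label y]))))"

definition mistakes :: "'x learner \<Rightarrow> 'x answerer \<Rightarrow> ('x \<times> bool) list \<Rightarrow> nat spmf" where
  "mistakes A Orc xys = mistakes_from A Orc xys []"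

definition expected_mistakes :: "'x learner \<Rightarrow> 'x answerer \<Rightarrow> ('x \<times> bool) list \<Rightarrow> ennreal" where
  "expected_mistakes A Orc xys = (\<integral>\<^sup>+ m. of_nat m \<partial>measure_spmf (mistakes A Orc xys))"

text \<open>What the oblivious adversary fixes in advance: a class of the family, a valid ERM answerer for it,
  and a realizable sequence of length \<open>T\<close>.\<close>

definition instances ::
    "'x concept set set \<Rightarrow> nat \<Rightarrow> ('x concept set \<times> 'x answerer \<times> ('x \<times> bool) list) set" where
  "instances F T = {(C, Orc, xys).
     C \<in> F \<and> erm_oracle C Orc \<and> length xys = T \<and> realizable C (set xys)}"

text \<open>On every instance the learner makes, with probability 1, only finitely many queries. Neither
  a bound on their number nor termination on inputs outside the family is demanded.\<close>

definition makes_finitely_many_queries ::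
    "'x learner \<Rightarrow> 'x concept set set \<Rightarrow> nat \<Rightarrow> bool" where
  "makes_finitely_many_queries A F T \<longleftrightarrow>
     (\<forall>(C, Orc, xys)\<in>instances F T. lossless_spmf (mistakes A Orc xys))"

definition worst_case_mistakes :: "'x learner \<Rightarrow> 'x concept set set \<Rightarrow> nat \<Rightarrow> ennreal" where
  "worst_case_mistakes A F T = (SUP (C, Orc, xys)\<in>instances F T. expected_mistakes A Orc xys)"

end

theory Submission
  imports Defs
begin

text \<open>For a list of distinct points with labels, consider the concepts that follow the list up to
  some position, take an arbitrary label at that position, and are undefined elsewhere, together
  with their restrictions. Deviating from the list at a point determines all other values, so the
  class has Littlestone dimension 1; being closed under restriction, it has an ERM oracle that
  returns nothing beyond the queried pairs and so only answers realizability.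

  Against a given learner the list is built adaptively. With the class of a list ending in \<open>x\<^sub>t\<close>, the
  label of \<open>x\<^sub>t\<close> affects neither class nor oracle, so one of the two labels is mispredicted
  with probability at least 1/2. Since almost surely only finitely many queries are made, there is
  a bound \<open>N\<close> such that with good probability all queried points in the first \<open>t\<close> rounds are below \<open>N\<close>.
  All later points are taken to be at least \<open>N\<close>: queries below \<open>N\<close> are answered alike for the list
  so far and for the complete list, so the mistake probability in round \<open>t\<close> is still at least 1/4
  for the final instance.\<close>

section \<open>Integrals over discrete subprobability distributions\<close>

lemma nn_integral_bind_spmf:
  "(\<integral>\<^sup>+ x. f x \<partial>measure_spmf (bind_spmf p g)) =
   (\<integral>\<^sup>+ y. \<integral>\<^sup>+ x. f x \<partial>measure_spmf (g y) \<partial>measure_spmf p)"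
  unfolding measure_spmf_bind o_def
  by (subst nn_integral_bind[where B = "count_space UNIV"])
     (auto simp: space_subprob_algebra)

lemma nn_integral_return_spmf:
  "(\<integral>\<^sup>+ x. f x \<partial>measure_spmf (return_spmf a)) = f a"
  by (simp add: measure_spmf_return_spmf nn_integral_return)

lemma nn_integral_const_lossless_spmf:
  "lossless_spmf p \<Longrightarrow> (\<integral>\<^sup>+ x. c \<partial>measure_spmf p) = c"
  by (simp add: lossless_spmf_def measure_spmf.emeasure_eq_measure weight_spmf_def[symmetric])

text \<open>The mass of a point in the lub of a chain is the supremum of its masses along the chain,
  so upper bounds pass to the limit. This opens \<open>query_phase\<close>, a least fixed point, to
  induction.\<close>

lemma admissible_spmf_le:
  "ccpo.admissible lub_spmf (ord_spmf (=)) (\<lambda>p. spmf p x \<le> c)"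
proof (rule ccpo.admissibleI)
  fix Y :: "'a spmf set"
  assume "Complete_Partial_Order.chain (ord_spmf (=)) Y" "Y \<noteq> {}" "\<forall>p\<in>Y. spmf p x \<le> c"
  then show "spmf (lub_spmf Y) x \<le> c"
    by (simp add: spmf_lub_spmf cSUP_least)
qed

section \<open>Oracles that agree on a set of queries\<close>

fun safe_event :: "('x \<times> bool) fset set \<Rightarrow> 'x event \<Rightarrow> bool" where
  "safe_event Q (Answer S _) = (S \<in> Q)"
| "safe_event Q _ = True"

abbreviation safe :: "('x \<times> bool) fset set \<Rightarrow> 'x event list \<Rightarrow> bool" where
  "safe Q h \<equiv> list_all (safe_event Q) h"

text \<open>Histories only grow, so a run that ends in a safe \<open>h'\<close> asked only queries
  in \<open>Q\<close> and got the same answers from both oracles. Fixed point induction delivers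
  upper bounds, hence the inequality.\<close>

lemma spmf_query_phase_le:
  assumes agree: "\<And>S. S \<in> Q \<Longrightarrow> Orc S = Orc' S" and h': "safe Q h'"
  shows "spmf (query_phase A Orc h) (h', p) \<le>
    of_bool (safe Q h) * spmf (query_phase A Orc' h) (h', p)"
proof -
  \<comment> \<open>Abstracted, since the fixed point induction would otherwise also replace this occurrence.\<close>
  define q' where "q' = query_phase A Orc'"
  have q': "q' h = A h \<bind> (\<lambda>a. case a of
      Query S \<Rightarrow> q' (h @ [Answer S (Orc' S)]) | Predict p \<Rightarrow> return_spmf (h, p))" for h
    unfolding q'_def by (subst query_phase.simps) simp
  have "\<forall>h. spmf (query_phase A Orc h) (h', p) \<le> of_bool (safe Q h) * spmf (q' h) (h', p)"
  proof (induction rule: query_phase.fixp_induct)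
    case 1
    show ?case
      unfolding curry_def
      by (intro admissible_all admissible_subst[OF admissible_spmf_le mcont_call])
  next
    case 2
    then show ?case by simp
  next
    case (3 q)
    show ?case
    proof
      fix h
      have "ennreal (spmf (A h \<bind> (\<lambda>a. case a of
          Query S \<Rightarrow> q A Orc (h @ [Answer S (Orc S)]) | Predict p \<Rightarrow> return_spmf (h, p))) (h', p))
        \<le> (\<integral>\<^sup>+ a. of_bool (safe Q h) * spmf (case a of
          Query S \<Rightarrow> q' (h @ [Answer S (Orc' S)]) | Predict p \<Rightarrow> return_spmf (h, p)) (h', p) \<partial>A h)"
        unfolding ennreal_pmf_bind
      proof (intro nn_integral_mono ennreal_leI)
        fix a
        show "spmf (case a of
            Query S \<Rightarrow> q A Orc (h @ [Answer S (Orc S)]) | Predict p \<Rightarrow> return_spmf (h, p)) (h', p)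
          \<le> of_bool (safe Q h) * spmf (case a of
            Query S \<Rightarrow> q' (h @ [Answer S (Orc' S)]) | Predict p \<Rightarrow> return_spmf (h, p)) (h', p)"
        proof (cases a)
          case (Query S)
          \<comment> \<open>For \<open>S\<close> outside \<open>Q\<close> the extended history is
            unsafe, and the induction hypothesis makes the left side 0.\<close>
          then show ?thesis
            using 3[rule_format, of "h @ [Answer S (Orc S)]"] agree[of S]
            by (cases "S \<in> Q") auto
        next
          case (Predict p')
          then show ?thesis using h' by (auto simp: indicator_def)
        qed
      qed
      also have "\<dots> = ennreal (of_bool (safe Q h) * spmf (q' h) (h', p))"
        by (subst (2) q') (auto simp: ennreal_pmf_bind)
      finally show "spmf (spmf_of_pmf (A h) \<bind> (\<lambda>a. case a of
          Query S \<Rightarrow> q A Orc (h @ [Answer S (Orc S)]) | Predict p \<Rightarrow> return_spmf (h, p))) (h', p)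
        \<le> of_bool (safe Q h) * spmf (q' h) (h', p)"
        by simp
    qed
  qed
  then show ?thesis unfolding q'_def by blast
qed

lemma nn_integral_query_phase_le:
  assumes agree: "\<And>S. S \<in> Q \<Longrightarrow> Orc S = Orc' S"
  shows "(\<integral>\<^sup>+ (h', p). of_bool (safe Q h') * f h' p \<partial>measure_spmf (query_phase A Orc h)) \<le>
    of_bool (safe Q h) * (\<integral>\<^sup>+ (h', p). f h' p \<partial>measure_spmf (query_phase A Orc' h))"
proof -
  have le: "ennreal (spmf (query_phase A Orc h) (h', p)) * of_bool (safe Q h')
      \<le> of_bool (safe Q h) * ennreal (spmf (query_phase A Orc' h) (h', p))" for h' p
    using spmf_query_phase_le[of Q Orc Orc' h' A h p, OF agree]
    by (cases "safe Q h'"; cases "safe Q h") (auto intro: ennreal_leI)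
  have "(\<integral>\<^sup>+ (h', p). of_bool (safe Q h') * f h' p \<partial>measure_spmf (query_phase A Orc h)) \<le>
    (\<integral>\<^sup>+ z. of_bool (safe Q h) * (ennreal (spmf (query_phase A Orc' h) z) * case_prod f z)
      \<partial>count_space UNIV)"
    unfolding nn_integral_measure_spmf
  proof (intro nn_integral_mono)
    fix z
    show "ennreal (spmf (query_phase A Orc h) z) * (case z of (h', p) \<Rightarrow> of_bool (safe Q h') * f h' p)
      \<le> of_bool (safe Q h) * (ennreal (spmf (query_phase A Orc' h) z) * case_prod f z)"
      using mult_right_mono[OF le[of "fst z" "snd z"], of "case_prod f z"]
      by (cases z) (simp only: prod.case fst_conv snd_conv mult.assoc zero_le)
  qed
  then show ?thesis
    by (simp add: nn_integral_measure_spmf nn_integral_cmult)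
qed

section \<open>Single rounds\<close>

text \<open>\<open>mistakes_from\<close> returns only a count; keeping the history beside the error
  flag makes it possible to speak about the queries asked.\<close>

definition play_round ::
    "'x learner \<Rightarrow> 'x answerer \<Rightarrow> 'x \<times> bool \<Rightarrow> 'x event list \<Rightarrow> ('x event list \<times> bool) spmf" where
  "play_round A Orc z h =
     bind_spmf (query_phase A Orc (h @ [Point (fst z)])) (\<lambda>(h', p).
     bind_spmf (spmf_of_pmf p) (\<lambda>b.
     return_spmf (h' @ [Predicted p b, Label (snd z)], b \<noteq> snd z)))"

fun transcript ::
    "'x learner \<Rightarrow> 'x answerer \<Rightarrow> ('x \<times> bool) list \<Rightarrow> 'x event list \<Rightarrow> 'x event list spmf" where
  "transcript A Orc [] h = return_spmf h"
| "transcript A Orc (z # zs) h =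
     bind_spmf (play_round A Orc z h) (\<lambda>(h', _). transcript A Orc zs h')"

text \<open>For \<open>P\<close> always true this is the probability of a mistake in the round after
  \<open>zs\<close>; otherwise a mistake counts only if the history at the end of that round
  satisfies \<open>P\<close>.\<close>

definition round_loss ::
    "('x event list \<Rightarrow> bool) \<Rightarrow> 'x learner \<Rightarrow> 'x answerer \<Rightarrow> ('x \<times> bool) list \<Rightarrow> 'x \<times> bool \<Rightarrow>
     'x event list \<Rightarrow> ennreal" where
  "round_loss P A Orc zs z h = (\<integral>\<^sup>+ h1. \<integral>\<^sup>+ (h2, e). of_bool (P h2) * of_bool e
     \<partial>measure_spmf (play_round A Orc z h1) \<partial>measure_spmf (transcript A Orc zs h))"

lemma nn_integral_play_round:
  "(\<integral>\<^sup>+ (h', e). f h' e \<partial>measure_spmf (play_round A Orc z h)) =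
   (\<integral>\<^sup>+ (h', p). \<integral>\<^sup>+ b. f (h' @ [Predicted p b, Label (snd z)]) (b \<noteq> snd z) \<partial>measure_pmf p
      \<partial>measure_spmf (query_phase A Orc (h @ [Point (fst z)])))"
  unfolding play_round_def
  by (simp only: nn_integral_bind_spmf nn_integral_return_spmf case_prod_unfold fst_conv snd_conv
      measure_spmf_spmf_of_pmf)

lemma nn_integral_play_round_le:
  assumes "\<And>S. S \<in> Q \<Longrightarrow> Orc S = Orc' S"
  shows "(\<integral>\<^sup>+ (h', e). of_bool (safe Q h') * f h' e \<partial>measure_spmf (play_round A Orc z h)) \<le>
    of_bool (safe Q h) * (\<integral>\<^sup>+ (h', e). f h' e \<partial>measure_spmf (play_round A Orc' z h))"
  unfolding nn_integral_play_round
  using nn_integral_query_phase_le[OF assms, where h = "h @ [Point (fst z)]" and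
      f = "\<lambda>h' p. \<integral>\<^sup>+ b. f (h' @ [Predicted p b, Label (snd z)]) (b \<noteq> snd z) \<partial>measure_pmf p"]
  by (simp add: nn_integral_cmult)

text \<open>The oracles are exchanged from the last round backwards: the indicator that the
  induction hypothesis leaves at the intermediate history is the one needed to exchange them in the
  round before.\<close>

lemma nn_integral_transcript_le:
  assumes "\<And>S. S \<in> Q \<Longrightarrow> Orc S = Orc' S"
  shows "(\<integral>\<^sup>+ h'. of_bool (safe Q h') * f h' \<partial>measure_spmf (transcript A Orc zs h)) \<le>
    of_bool (safe Q h) * (\<integral>\<^sup>+ h'. f h' \<partial>measure_spmf (transcript A Orc' zs h))"
proof (induction zs arbitrary: h)
  case Nil
  then show ?case by (simp add: nn_integral_return_spmf)
next
  case (Cons z zs)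
  have "(\<integral>\<^sup>+ h'. of_bool (safe Q h') * f h' \<partial>measure_spmf (transcript A Orc (z # zs) h)) =
    (\<integral>\<^sup>+ (h1, e). \<integral>\<^sup>+ h'. of_bool (safe Q h') * f h' \<partial>measure_spmf (transcript A Orc zs h1)
      \<partial>measure_spmf (play_round A Orc z h))"
    by (simp add: nn_integral_bind_spmf case_prod_unfold)
  also have "\<dots> \<le> (\<integral>\<^sup>+ (h1, e). of_bool (safe Q h1) *
      (\<integral>\<^sup>+ h'. f h' \<partial>measure_spmf (transcript A Orc' zs h1)) \<partial>measure_spmf (play_round A Orc z h))"
    by (intro nn_integral_mono) (simp add: Cons.IH case_prod_unfold)
  also have "\<dots> \<le> of_bool (safe Q h) * (\<integral>\<^sup>+ (h1, e).
      (\<integral>\<^sup>+ h'. f h' \<partial>measure_spmf (transcript A Orc' zs h1)) \<partial>measure_spmf (play_round A Orc' z h))"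
    by (rule nn_integral_play_round_le[OF assms])
  finally show ?case
    by (simp add: nn_integral_bind_spmf case_prod_unfold)
qed

text \<open>Transfers a lower bound from the oracle of a prefix to the oracle of the final
  instance.\<close>

lemma round_loss_le:
  assumes "\<And>S. S \<in> Q \<Longrightarrow> Orc S = Orc' S"
  shows "round_loss (safe Q) A Orc zs z h \<le> round_loss (\<lambda>_. True) A Orc' zs z h"
proof -
  have "round_loss (safe Q) A Orc zs z h \<le>
    (\<integral>\<^sup>+ h1. of_bool (safe Q h1) * (\<integral>\<^sup>+ (h2, e). of_bool e \<partial>measure_spmf (play_round A Orc' z h1))
       \<partial>measure_spmf (transcript A Orc zs h))"
    unfolding round_loss_def
    by (intro nn_integral_mono nn_integral_play_round_le[OF assms])
  also have "\<dots> \<le> of_bool (safe Q h) * round_loss (\<lambda>_. True) A Orc' zs z h"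
    unfolding round_loss_def of_bool_eq mult_1
    by (rule nn_integral_transcript_le[OF assms])
  also have "\<dots> \<le> round_loss (\<lambda>_. True) A Orc' zs z h"
    by simp
  finally show ?thesis .
qed

lemma mistakes_from_Cons:
  "mistakes_from A Orc (z # zs) h = bind_spmf (play_round A Orc z h) (\<lambda>(h', e).
     map_spmf (\<lambda>m. of_bool e + m) (mistakes_from A Orc zs h'))"
  by (cases z) (simp add: play_round_def case_prod_unfold del: bind_spmf_of_pmf)

text \<open>Linearity of expectation. Without losslessness, a mistake followed by divergence would
  enter its \<open>round_loss\<close> but not the count.\<close>

lemma nn_integral_mistakes_from:
  assumes "lossless_spmf (mistakes_from A Orc zs h)"
  shows "(\<integral>\<^sup>+ m. of_nat m \<partial>measure_spmf (mistakes_from A Orc zs h)) =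
    (\<Sum>i<length zs. round_loss (\<lambda>_. True) A Orc (take i zs) (zs ! i) h)"
  using assms
proof (induction zs arbitrary: h)
  case Nil
  then show ?case by (simp add: nn_integral_return_spmf)
next
  case (Cons z zs)
  let ?R = "measure_spmf (play_round A Orc z h)"
  let ?L = "\<lambda>i. round_loss (\<lambda>_. True) A Orc (take i zs) (zs ! i)"
  have rest: "lossless_spmf (mistakes_from A Orc zs (fst w))"
    if "w \<in> set_spmf (play_round A Orc z h)" for w
    using Cons.prems that
    by (auto simp: mistakes_from_Cons case_prod_unfold simp del: mistakes_from.simps)
  have "(\<integral>\<^sup>+ m. of_nat m \<partial>measure_spmf (mistakes_from A Orc (z # zs) h)) =
    (\<integral>\<^sup>+ w. \<integral>\<^sup>+ m. of_bool (snd w) + of_nat m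
       \<partial>measure_spmf (mistakes_from A Orc zs (fst w)) \<partial>?R)"
    by (simp add: mistakes_from_Cons nn_integral_bind_spmf case_prod_unfold o_def
        del: mistakes_from.simps)
  also have "\<dots> = (\<integral>\<^sup>+ w. of_bool (snd w) + (\<Sum>i<length zs. ?L i (fst w)) \<partial>?R)"
    using rest Cons.IH
    by (intro nn_integral_cong_AE)
       (simp add: nn_integral_add nn_integral_const_lossless_spmf del: nn_integral_const)
  also have "\<dots> = (\<integral>\<^sup>+ w. of_bool (snd w) \<partial>?R) + (\<Sum>i<length zs. \<integral>\<^sup>+ w. ?L i (fst w) \<partial>?R)"
    by (simp add: nn_integral_add nn_integral_sum)
  also have "\<dots> = (\<Sum>i<length (z # zs).
      round_loss (\<lambda>_. True) A Orc (take i (z # zs)) ((z # zs) ! i) h)"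
    by (simp add: sum.lessThan_Suc_shift round_loss_def nn_integral_bind_spmf
        nn_integral_return_spmf case_prod_unfold del: sum.lessThan_Suc)
  finally show ?case .
qed

text \<open>A run that almost surely ends almost surely reaches the prediction in each of its
  rounds.\<close>

lemma lossless_query_phase:
  assumes "lossless_spmf (mistakes_from A Orc (zs @ z # zs') h)"
  shows "lossless_spmf
    (transcript A Orc zs h \<bind> (\<lambda>h'. query_phase A Orc (h' @ [Point (fst z)])))"
  using assms
proof (induction zs arbitrary: h)
  case Nil
  then show ?case by (cases z) simp
next
  case (Cons w zs)
  then show ?case
    by (auto simp: mistakes_from_Cons case_prod_unfold simp del: mistakes_from.simps)
qed

section \<open>The family of classes\<close>

text \<open>\<open>p\<close> is the part of the list that is followed, and \<open>z\<close> the
  entry at whose point either label is allowed. The implication leaves \<open>c\<close> free to be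
  undefined at any of these points.\<close>

definition branch_class :: "('x \<times> bool) list \<Rightarrow> 'x concept set" where
  "branch_class l = {c. \<exists>p z s. l = p @ z # s \<and>
     (\<forall>x y. c x = Some y \<longrightarrow> (x, y) \<in> set p \<or> x = fst z)}"

text \<open>The choice of \<open>y\<close> is unique when \<open>S\<close> is realizable, the only
  case in which \<open>branch_oracle\<close> returns this concept.\<close>

definition minimal_concept :: "('x \<times> bool) set \<Rightarrow> 'x concept" where
  "minimal_concept S x = (if x \<in> fst ` S then Some (SOME y. (x, y) \<in> S) else None)"

definition branch_oracle :: "('x \<times> bool) list \<Rightarrow> 'x answerer" where
  "branch_oracle l S =
     (if realizable (branch_class l) (fset S) then Some (minimal_concept (fset S)) else None)"

section \<open>Valid oracle answers and realizable lists\<close>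

lemma minimal_concept_SomeD:
  assumes "minimal_concept S x = Some y"
  shows "(x, y) \<in> S"
  using assms by (auto simp: minimal_concept_def split: if_splits intro: someI)

lemma consistent_minimal_concept:
  assumes "consistent c S"
  shows "consistent (minimal_concept S) S"
proof -
  have c: "c x = Some y" if "(x, y) \<in> S" for x y
    using assms that by (auto simp: consistent_def)
  have "y' = y" if "(x, y) \<in> S" "(x, y') \<in> S" for x y y'
    using c[OF that(1)] c[OF that(2)] by simp
  then have "(SOME y'. (x, y') \<in> S) = y" if "(x, y) \<in> S" for x y
    using that by (intro some_equality)
  then show ?thesis
    by (force simp: consistent_def minimal_concept_def)
qed

lemma branch_class_restrict:
  assumes "c \<in> branch_class l" "c' \<subseteq>\<^sub>m c"
  shows "c' \<in> branch_class l"
proof -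
  have "c x = Some y" if "c' x = Some y" for x y
    using assms(2) that by (metis domI map_le_def)
  then show ?thesis
    using assms(1) unfolding branch_class_def by blast
qed

lemma erm_oracle_branch_oracle: "erm_oracle (branch_class l) (branch_oracle l)"
  unfolding erm_oracle_def
proof
  fix S :: "('a \<times> bool) fset"
  have "\<exists>c\<in>branch_class l. consistent c (fset S) \<and> branch_oracle l S = Some c"
    if real: "realizable (branch_class l) (fset S)"
  proof -
    from real obtain c where c: "c \<in> branch_class l" "consistent c (fset S)"
      by (auto simp: realizable_def)
    have "minimal_concept (fset S) \<subseteq>\<^sub>m c"
      using c(2) by (force simp: map_le_def consistent_def dest: minimal_concept_SomeD)
    then show ?thesis
      using real c consistent_minimal_concept[OF c(2)] branch_class_restrict[OF c(1)]
      by (auto simp: branch_oracle_def)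
  qed
  then show "if realizable (branch_class l) (fset S)
      then \<exists>c\<in>branch_class l. consistent c (fset S) \<and> branch_oracle l S = Some c
      else branch_oracle l S = None"
    by (simp add: branch_oracle_def)
qed

text \<open>The last entry of a list can only be the deviation entry \<open>z\<close> or lie behind
  it, never in \<open>p\<close>, so its label constrains no concept.\<close>

lemma branch_class_snoc_label: "branch_class (l @ [(x, y)]) = branch_class (l @ [(x, y')])"
proof -
  have "branch_class (l @ [(x, y)]) \<subseteq> branch_class (l @ [(x, y')])" for y y'
  proof
    fix c assume "c \<in> branch_class (l @ [(x, y)])"
    then obtain p z s where l: "l @ [(x, y)] = p @ z # s"
      and c: "\<forall>x y. c x = Some y \<longrightarrow> (x, y) \<in> set p \<or> x = fst z"
      by (auto simp: branch_class_def)
    \<comment> \<open>If \<open>s\<close> is empty, the relabelled entry is \<open>z\<close> itself;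
      otherwise it is the last entry of \<open>s\<close>.\<close>
    obtain z' s' where "l @ [(x, y')] = p @ z' # s'" "fst z' = fst z"
      using l by (cases s rule: rev_cases) auto
    with c show "c \<in> branch_class (l @ [(x, y')])"
      unfolding branch_class_def by (intro CollectI exI[of _ p] exI[of _ z'] exI[of _ s']) simp
  qed
  then show ?thesis by blast
qed

lemma realizable_branch_class:
  assumes "l \<noteq> []" "distinct (map fst l)"
  shows "realizable (branch_class l) (set l)"
proof -
  from assms(1) obtain p z where l: "l = p @ [z]"
    by (metis rev_exhaust)
  have "(x, y) \<in> set p \<or> x = fst z" if "map_of l x = Some y" for x y
    using map_of_SomeD[OF that] by (auto simp: l)
  then have "map_of l \<in> branch_class l"
    unfolding branch_class_def using l by blast
  moreover have "consistent (map_of l) (set l)"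
    using assms(2) by (auto simp: consistent_def)
  ultimately show ?thesis
    by (auto simp: realizable_def)
qed

section \<open>Littlestone dimension of the branch classes\<close>

lemma realizable_branch_class_single:
  assumes "l \<noteq> []"
  shows "realizable (branch_class l) {(fst (hd l), y)}"
proof -
  from assms obtain z s where "l = z # s"
    by (cases l) auto
  then have "[fst (hd l) \<mapsto> y] \<in> branch_class l"
    unfolding branch_class_def by (fastforce split: if_splits)
  then show ?thesis
    unfolding realizable_def consistent_def by (rule bexI[rotated]) simp
qed

text \<open>The wrong label at \<open>x\<close> is possible only if the deviation happens there.
  Since the points are distinct, this fixes the split of the list, and \<open>c\<close> is confined
  to \<open>p\<close> and its value at \<open>x\<close>.\<close>

lemma branch_class_off_path:
  assumes "distinct (map fst (p @ (x, y) # s))" "c \<in> branch_class (p @ (x, y) # s)"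
    "c x = Some (\<not> y)" "c u = Some v"
  shows "(u, v) \<in> set p \<or> (u, v) = (x, \<not> y)"
proof -
  from assms(2) obtain p' z' s' where l: "p @ (x, y) # s = p' @ z' # s'"
    and c: "\<And>x y. c x = Some y \<Longrightarrow> (x, y) \<in> set p' \<or> x = fst z'"
    by (auto simp: branch_class_def)
  have "(x, \<not> y) \<notin> set (p @ (x, y) # s)"
    using assms(1) by force
  then have "fst z' = x"
    using c[OF assms(3)] l by auto
  moreover have "z' \<in> set (p @ (x, y) # s)"
    using l by simp
  ultimately have "z' = (x, y)"
    using assms(1) by force
  moreover have "(x, y) \<notin> set p \<union> set s"
    using assms(1) by force
  ultimately have "p' = p"
    using l append_Cons_eq_iff[of "(x, y)" p s p' s'] by simp
  then show ?thesis
    using c[OF assms(4)] \<open>z' = (x, y)\<close> assms(3,4) by auto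
qed

text \<open>In a tree of depth 2 with root \<open>x\<close>, follow the edge that contradicts the
  label of \<open>x\<close> in the list. Beyond it all values are forced, so the child
  \<open>w\<close> cannot take both labels.\<close>

lemma branch_class_not_shattered:
  assumes "distinct (map fst l)"
    "\<And>b b'. realizable (branch_class l) {(x, b), (if b then v else u, b')}"
  shows False
proof -
  have ex: "\<exists>c\<in>branch_class l. c x = Some b \<and> c (if b then v else u) = Some b'" for b b'
    using assms(2)[of b b'] by (auto simp: realizable_def consistent_def)
  have "x \<in> fst ` set l"
  proof -
    from ex[of True True] obtain c where "c \<in> branch_class l" "c x = Some True" by auto
    then show ?thesis by (force simp: branch_class_def)
  qed
  then obtain y p s where l: "l = p @ (x, y) # s"
    by (metis (no_types, lifting) imageE prod.collapse split_list)
  define w where "w = (if \<not> y then v else u)"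
  have "(w, b') \<in> set p \<or> (w, b') = (x, \<not> y)" for b'
  proof -
    from ex[of "\<not> y" b'] obtain c
      where "c \<in> branch_class l" "c x = Some (\<not> y)" "c w = Some b'"
      unfolding w_def by blast
    then show ?thesis
      using branch_class_off_path assms(1) l by metis
  qed
  \<comment> \<open>If \<open>w\<close> is \<open>x\<close>, the label \<open>y\<close> would have
    to come from \<open>p\<close>, which avoids \<open>x\<close>; otherwise both labels of
    \<open>w\<close> would occur in \<open>p\<close>.\<close>
  moreover have "(w, True) \<notin> set p \<or> (w, False) \<notin> set p" "x \<notin> fst ` set p"
    using assms(1) inj_onD[of fst "set p" "(w, True)" "(w, False)"]
    unfolding l by (auto simp: distinct_map)
  ultimately show False
    by (metis (full_types) fst_conv image_eqI prod.inject)
qed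

lemma root_to_leaf_paths_nonempty: "root_to_leaf_paths t \<noteq> {}"
  by (induction t) auto

lemma realizable_mono:
  assumes "realizable C S" "S' \<subseteq> S"
  shows "realizable C S'"
proof -
  from assms(1) obtain c where "c \<in> C" "consistent c S"
    by (auto simp: realizable_def)
  moreover from this(2) assms(2) have "consistent c S'"
    unfolding consistent_def by (rule ballI[OF bspec[OF _ subsetD]])
  ultimately show ?thesis
    by (auto simp: realizable_def)
qed

lemma littlestone_dim_branch_class:
  assumes "l \<noteq> []" "distinct (map fst l)"
  shows "littlestone_dim (branch_class l) = 1"
proof (rule antisym)
  show "littlestone_dim (branch_class l) \<le> 1"
    unfolding littlestone_dim_def
  proof (rule SUP_least)
    fix t assume "t \<in> {t. shattered_tree (branch_class l) t}"
    then have t: "complete t"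
      and real: "\<And>p. p \<in> root_to_leaf_paths t \<Longrightarrow> realizable (branch_class l) (set p)"
      by (auto simp: shattered_tree_def)
    show "enat (height t) \<le> 1"
    proof (rule ccontr)
      assume "\<not> enat (height t) \<le> 1"
      then have "height t \<ge> 2" by (simp add: one_enat_def)
      then obtain tl x tr where t_eq1: "t = \<langle>tl, x, tr\<rangle>"
        by (cases t) auto
      with t \<open>height t \<ge> 2\<close> have "height tl \<noteq> 0" "height tr \<noteq> 0"
        by auto
      then obtain t1 u t2 t3 v t4 where t_eq: "t = \<langle>\<langle>t1, u, t2\<rangle>, x, \<langle>t3, v, t4\<rangle>\<rangle>"
        unfolding t_eq1 by (metis eq_height_0 neq_Leaf_iff)
      obtain q1 q2 q3 q4 where "q1 \<in> root_to_leaf_paths t1" "q2 \<in> root_to_leaf_paths t2"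
          "q3 \<in> root_to_leaf_paths t3" "q4 \<in> root_to_leaf_paths t4"
        using root_to_leaf_paths_nonempty by (metis ex_in_conv)
      then have paths: "(x, False) # (u, False) # q1 \<in> root_to_leaf_paths t"
          "(x, False) # (u, True) # q2 \<in> root_to_leaf_paths t"
          "(x, True) # (v, False) # q3 \<in> root_to_leaf_paths t"
          "(x, True) # (v, True) # q4 \<in> root_to_leaf_paths t"
        by (auto simp: t_eq)
      have "realizable (branch_class l) {(x, b), (if b then v else u, b')}" for b b'
        using paths[THEN real, THEN realizable_mono, of "{(x, b), (if b then v else u, b')}"]
        by (cases b; cases b') simp_all
      then show False
        by (rule branch_class_not_shattered[OF assms(2)])
    qed
  qed
next
  \<comment> \<open>A concept that deviates at the very first entry takes either label
    there.\<close>
  have "shattered_tree (branch_class l) \<langle>\<langle>\<rangle>, fst (hd l), \<langle>\<rangle>\<rangle>"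
    using realizable_branch_class_single[OF assms(1)] by (auto simp: shattered_tree_def)
  then have "enat (height \<langle>\<langle>\<rangle>, fst (hd l), \<langle>\<rangle>\<rangle>) \<le> littlestone_dim (branch_class l)"
    unfolding littlestone_dim_def by (intro SUP_upper) simp
  then show "1 \<le> littlestone_dim (branch_class l)"
    by (simp add: one_enat_def)
qed

section \<open>The adaptive choice of the instance\<close>

definition queries_below :: "nat \<Rightarrow> (nat \<times> bool) fset set" where
  "queries_below N = {S. fst ` fset S \<subseteq> {..<N}}"

text \<open>A concept that deviates beyond \<open>p\<close>, restricted to the points of
  \<open>S\<close>, only follows \<open>p\<close>; the last entry of \<open>p\<close> then serves as
  its deviation entry. Conversely, the class grows with the list.\<close>

lemma realizable_branch_class_append:
  assumes "p \<noteq> []" "\<And>w. w \<in> set s \<Longrightarrow> fst w \<notin> fst ` S"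
  shows "realizable (branch_class (p @ s)) S \<longleftrightarrow> realizable (branch_class p) S"
proof
  assume "realizable (branch_class (p @ s)) S"
  then obtain c p1 z s1 where c: "consistent c S" "p @ s = p1 @ z # s1"
      "\<And>x y. c x = Some y \<Longrightarrow> (x, y) \<in> set p1 \<or> x = fst z"
    by (auto simp: realizable_def branch_class_def)
  let ?c = "c |` (fst ` S)"
  have cons: "consistent ?c S"
    using c(1) by (force simp: consistent_def restrict_map_def)
  have "?c \<in> branch_class p"
  proof (cases "length p1 < length p")
    case True
    then obtain s2 where "p = p1 @ z # s2"
      using c(2) by (auto simp: append_eq_append_conv2 append_eq_Cons_conv)
    then have "c \<in> branch_class p"
      using c(3) unfolding branch_class_def by blast
    then show ?thesis
      by (rule branch_class_restrict) (auto simp: map_le_def restrict_map_def)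
  next
    case False
    then obtain s2 where s2: "p1 = p @ s2" "s = s2 @ z # s1"
      using c(2) by (auto simp: append_eq_append_conv2)
    have z: "fst z \<notin> fst ` S"
      by (rule assms(2)) (simp add: s2)
    from assms(1) obtain p2 z2 where p: "p = p2 @ [z2]"
      by (metis rev_exhaust)
    have "(x, y) \<in> set p2 \<or> x = fst z2" if "?c x = Some y" for x y
    proof -
      have "x \<in> fst ` S" "c x = Some y"
        using that by (auto simp: restrict_map_def split: if_splits)
      moreover from this have "(x, y) \<notin> set s" "x \<noteq> fst z"
        using assms(2)[of "(x, y)", unfolded fst_conv] z by blast+
      ultimately have "(x, y) \<in> set p"
        using c(3)[of x y] s2 by auto
      then show ?thesis
        using p by auto
    qed
    then show ?thesis
      unfolding branch_class_def using p by blast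
  qed
  with cons show "realizable (branch_class p) S"
    by (auto simp: realizable_def)
next
  assume "realizable (branch_class p) S"
  moreover have "branch_class p \<subseteq> branch_class (p @ s)"
    unfolding branch_class_def by (smt (verit) Collect_mono append.assoc append_Cons)
  ultimately show "realizable (branch_class (p @ s)) S"
    by (auto simp: realizable_def)
qed

lemma branch_oracle_append:
  assumes "p \<noteq> []" "\<And>w. w \<in> set s \<Longrightarrow> N \<le> fst w" "S \<in> queries_below N"
  shows "branch_oracle p S = branch_oracle (p @ s) S"
proof -
  have "realizable (branch_class (p @ s)) (fset S) \<longleftrightarrow> realizable (branch_class p) (fset S)"
    using assms(2,3)
    by (intro realizable_branch_class_append assms(1)) (fastforce simp: queries_below_def)
  then show ?thesis by (simp add: branch_oracle_def)
qed

section \<open>Bounds on the queried points and the loss of one round\<close>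

lemma safe_event_queries_below_mono:
  "safe_event (queries_below N) e \<Longrightarrow> N \<le> N' \<Longrightarrow> safe_event (queries_below N') e"
  by (cases e) (auto simp: queries_below_def)

lemma safe_queries_below_mono:
  "safe (queries_below N) h \<Longrightarrow> N \<le> N' \<Longrightarrow> safe (queries_below N') h"
  by (erule list.pred_mono_strong) (rule safe_event_queries_below_mono)

lemma ex_safe_queries_below: "\<exists>N. safe (queries_below N) h"
proof (induction h)
  case Nil
  then show ?case by simp
next
  case (Cons e h)
  have "\<exists>N. safe_event (queries_below N) e"
  proof (cases e)
    case (Answer S a)
    have "finite (fst ` fset S)" by simp
    then obtain N where "\<forall>x\<in>fst ` fset S. x < N"
      using finite_nat_set_iff_bounded by blast
    then show ?thesis using Answer by (auto simp: queries_below_def)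
  qed auto
  with Cons.IH obtain N N' where "safe_event (queries_below N) e" "safe (queries_below N') h"
    by blast
  then have "safe (queries_below (max N N')) (e # h)"
    by (auto intro: safe_queries_below_mono safe_event_queries_below_mono)
  then show ?case by blast
qed

text \<open>Continuity from below: every finite history is safe for some \<open>N\<close>, so the
  events increase to the whole space, of mass 1, and one of them exceeds 1/2.\<close>

lemma ex_queries_below_likely:
  fixes G :: "(nat event list \<times> 'a) spmf"
  assumes "lossless_spmf G"
  shows "\<exists>N. (\<integral>\<^sup>+ (h, p). of_bool (safe (queries_below N) h) \<partial>measure_spmf G) \<ge> ennreal (1 / 2)"
proof -
  define B :: "nat \<Rightarrow> (nat event list \<times> 'a) set" where "B N = {w. safe (queries_below N) (fst w)}" for N
  have half: "ennreal (1 / 2) < ennreal 1"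
    by (subst ennreal_less_iff) auto
  have "(SUP N. emeasure (measure_spmf G) (B N)) = emeasure (measure_spmf G) (\<Union>N. B N)"
    by (rule SUP_emeasure_incseq)
       (auto simp: incseq_def B_def intro: safe_queries_below_mono)
  also have "(\<Union>N. B N) = UNIV"
    using ex_safe_queries_below by (auto simp: B_def)
  also have "emeasure (measure_spmf G) UNIV = 1"
    using nn_integral_const_lossless_spmf[OF assms, of 1]
    unfolding nn_integral_const space_measure_spmf by simp
  finally have "ennreal (1 / 2) < (SUP N. emeasure (measure_spmf G) (B N))"
    using half by (simp only: ennreal_1)
  then obtain N where "ennreal (1 / 2) < emeasure (measure_spmf G) (B N)"
    by (auto simp: less_SUP_iff)
  also have "emeasure (measure_spmf G) (B N) = (\<integral>\<^sup>+ w. indicator (B N) w \<partial>measure_spmf G)"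
    by simp
  also have "\<dots> = (\<integral>\<^sup>+ (h, p). of_bool (safe (queries_below N) h) \<partial>measure_spmf G)"
    by (rule nn_integral_cong) (simp add: B_def indicator_def case_prod_unfold)
  finally show ?thesis by (auto intro: less_imp_le)
qed

text \<open>\<open>Orc\<close> is the same for both values of \<open>y\<close>, so the two losses
  refer to the same run up to the prediction. They add up to the probability of a safe history, at
  least 1/2, and one is at least half of it.\<close>

lemma ex_round_loss_ge:
  assumes "lossless_spmf
    (transcript A Orc zs h \<bind> (\<lambda>h'. query_phase A Orc (h' @ [Point x])))" (is "lossless_spmf ?G")
  shows "\<exists>y N. round_loss (safe (queries_below N)) A Orc zs (x, y) h \<ge> ennreal (1 / 4)"
proof -
  from ex_queries_below_likely[OF assms] obtain N
    where N: "ennreal (1 / 2) \<le>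
      (\<integral>\<^sup>+ (h, p). of_bool (safe (queries_below N) h) \<partial>measure_spmf ?G)" ..
  let ?r = "\<lambda>y. round_loss (safe (queries_below N)) A Orc zs (x, y) h"
  \<comment> \<open>The events \<open>Predicted\<close> and \<open>Label\<close> are always safe, so
    safety is decided before the prediction is drawn.\<close>
  have r: "?r y = (\<integral>\<^sup>+ w. \<integral>\<^sup>+ b. of_bool (safe (queries_below N) (fst w)) * of_bool (b \<noteq> y)
      \<partial>measure_pmf (snd w) \<partial>measure_spmf ?G)" for y
    unfolding round_loss_def nn_integral_play_round nn_integral_bind_spmf
    by (simp add: case_prod_unfold)
  have add: "(\<integral>\<^sup>+ w. \<integral>\<^sup>+ b. f w b + g w b \<partial>measure_pmf (snd w) \<partial>measure_spmf ?G) =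
    (\<integral>\<^sup>+ w. \<integral>\<^sup>+ b. f w b \<partial>measure_pmf (snd w) \<partial>measure_spmf ?G) +
    (\<integral>\<^sup>+ w. \<integral>\<^sup>+ b. g w b \<partial>measure_pmf (snd w) \<partial>measure_spmf ?G)" for f g
    by (simp add: nn_integral_add)
  have split: "of_bool P * of_bool (b \<noteq> True) + of_bool P * of_bool (b \<noteq> False) =
      (of_bool P :: ennreal)" for P b by (cases b) auto
  have "?r True + ?r False = (\<integral>\<^sup>+ w. \<integral>\<^sup>+ b.
      of_bool (safe (queries_below N) (fst w)) * of_bool (b \<noteq> True) +
      of_bool (safe (queries_below N) (fst w)) * of_bool (b \<noteq> False)
      \<partial>measure_pmf (snd w) \<partial>measure_spmf ?G)"
    unfolding r add ..
  also have "\<dots> = (\<integral>\<^sup>+ w. of_bool (safe (queries_below N) (fst w)) \<partial>measure_spmf ?G)"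
    unfolding split by simp
  finally have "?r True + ?r False =
    (\<integral>\<^sup>+ w. of_bool (safe (queries_below N) (fst w)) \<partial>measure_spmf ?G)" .
  with N have sum: "ennreal (1 / 2) \<le> ?r True + ?r False"
    by (simp add: case_prod_unfold)
  show ?thesis
  proof (rule ccontr)
    assume "\<not> ?thesis"
    then have "?r True < ennreal (1 / 4)" "?r False < ennreal (1 / 4)"
      by (auto simp: not_le)
    then have "?r True + ?r False < ennreal (1 / 4) + ennreal (1 / 4)"
      by (rule add_strict_mono)
    with sum show False
      by (simp flip: ennreal_plus)
  qed
qed

section \<open>The hard instance for a given learner\<close>

definition branch_family :: "nat concept set set" where
  "branch_family = {branch_class l | l. l \<noteq> [] \<and> distinct (map fst l)}"

text \<open>\<open>xys\<close> may repeat or omit entries of \<open>l\<close>, which permits padding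
  an unfinished list to length \<open>T\<close>.\<close>

lemma branch_instance:
  assumes "makes_finitely_many_queries A branch_family T"
    "l \<noteq> []" "distinct (map fst l)" "length xys = T" "set xys \<subseteq> set l"
  shows "(branch_class l, branch_oracle l, xys) \<in> instances branch_family T"
    and "lossless_spmf (mistakes A (branch_oracle l) xys)"
proof -
  show inst: "(branch_class l, branch_oracle l, xys) \<in> instances branch_family T"
    using assms(2-5) erm_oracle_branch_oracle
      realizable_mono[OF realizable_branch_class[OF assms(2,3)] assms(5)]
    by (auto simp: instances_def branch_family_def)
  then show "lossless_spmf (mistakes A (branch_oracle l) xys)"
    using assms(1) by (auto simp: makes_finitely_many_queries_def)
qed

text \<open>The loss at \<open>z\<close> refers to the oracle of the list cut off after
  \<open>z\<close>, so it is unaffected by extending \<open>l\<close>. \<open>B\<close> exceeds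
  every point and bounds every threshold \<open>N\<close>, hence is itself a legitimate next
  point.\<close>

lemma ex_hard_sequence:
  assumes fin: "makes_finitely_many_queries A branch_family T"
  shows "k \<le> T \<Longrightarrow> \<exists>l B. length l = k \<and> distinct (map fst l) \<and> (\<forall>w\<in>set l. fst w < B) \<and>
    (\<forall>p z s. l = p @ z # s \<longrightarrow> (\<exists>N\<le>B. (\<forall>w\<in>set s. N \<le> fst w) \<and>
       round_loss (safe (queries_below N)) A (branch_oracle (p @ [z])) p z [] \<ge> ennreal (1 / 4)))"
proof (induction k)
  case 0
  then show ?case by simp
next
  case (Suc k)
  then obtain l B where l: "length l = k" "distinct (map fst l)" "\<And>w. w \<in> set l \<Longrightarrow> fst w < B"
    and loss: "\<And>p z s. l = p @ z # s \<Longrightarrow> \<exists>N\<le>B. (\<forall>w\<in>set s. N \<le> fst w) \<and>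
       round_loss (safe (queries_below N)) A (branch_oracle (p @ [z])) p z [] \<ge> ennreal (1 / 4)"
    by auto
  let ?l = "\<lambda>y. l @ [(B, y)]"
  have dist: "distinct (map fst (?l y))" for y
    using l(2,3) by force
  have Orc: "branch_oracle (?l True) = branch_oracle (?l y)" for y
    using branch_class_snoc_label[of l B True y] by (auto simp: branch_oracle_def fun_eq_iff)
  \<comment> \<open>Repeating the last point pads the sequence to length \<open>T\<close>, so the hypothesis on \<open>A\<close> applies.\<close>
  have "lossless_spmf (mistakes A (branch_oracle (?l True))
      (l @ (B, True) # replicate (T - k - 1) (B, True)))"
    using Suc.prems l(1) by (intro branch_instance[OF fin _ dist]) auto
  then have "lossless_spmf (transcript A (branch_oracle (?l True)) l [] \<bind>
      (\<lambda>h'. query_phase A (branch_oracle (?l True)) (h' @ [Point B])))"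
    unfolding mistakes_def by (drule_tac lossless_query_phase) simp
  \<comment> \<open>The label \<open>y\<close> is fixed only here; by \<open>Orc\<close>, using
    \<open>True\<close> in the oracle so far did not prejudge it.\<close>
  from ex_round_loss_ge[OF this] obtain y N where
    "round_loss (safe (queries_below N)) A (branch_oracle (?l True)) l (B, y) [] \<ge> ennreal (1 / 4)"
    by auto
  then have yN:
    "round_loss (safe (queries_below N)) A (branch_oracle (?l y)) l (B, y) [] \<ge> ennreal (1 / 4)"
    by (subst Orc[symmetric])
  let ?B = "max (Suc B) N"
  have split: "\<exists>N\<le>?B. (\<forall>w\<in>set s. N \<le> fst w) \<and>
       round_loss (safe (queries_below N)) A (branch_oracle (p @ [z])) p z [] \<ge> ennreal (1 / 4)"
    if eq: "?l y = p @ z # s" for p z s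
  proof (cases s rule: rev_cases)
    case Nil
    then have "p = l" "z = (B, y)" using eq by auto
    then show ?thesis using yN Nil by (intro exI[of _ N]) simp
  next
    case (snoc s' w)
    then have "l = p @ z # s'" and w: "w = (B, y)" using eq by auto
    from loss[OF this(1)] obtain N' where N': "N' \<le> B" "\<forall>w\<in>set s'. N' \<le> fst w"
      "round_loss (safe (queries_below N')) A (branch_oracle (p @ [z])) p z [] \<ge> ennreal (1 / 4)"
      by blast
    \<comment> \<open>For an old position only the new entry has to be checked, and its point
      \<open>B\<close> is at least \<open>N'\<close>.\<close>
    show ?thesis
      using N' by (intro exI[of _ N'] conjI) (simp_all add: snoc w)
  qed
  show ?case
  proof (rule exI[of _ "?l y"], rule exI[of _ ?B], intro conjI)
    show "length (?l y) = Suc k" by (simp add: l(1))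
    show "distinct (map fst (?l y))" by (rule dist)
    show "\<forall>w\<in>set (?l y). fst w < ?B" using l(3) by (auto simp: less_max_iff_disj less_Suc_eq)
  qed (intro allI impI, rule split)
qed

theorem theorem3p5:
  shows "\<exists>(c::real) (X::nat set) (F::nat concept set set).
    c > 0 \<and>
    (\<forall>C\<in>F. C \<subseteq> partial_concepts X \<and> littlestone_dim C = 1) \<and>
    (\<forall>T\<ge>1. \<forall>A. makes_finitely_many_queries A F T \<longrightarrow>
       worst_case_mistakes A F T \<ge> ennreal (c * real T))"
proof (intro exI conjI ballI allI impI)
  \<comment> \<open>A factor 1/2 is lost to unsafe histories and another 1/2 to the choice of the
    worse label.\<close>
  show "(1 / 4 :: real) > 0" by simp
next
  fix C :: "nat concept set" assume C: "C \<in> branch_family"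
  show "C \<subseteq> partial_concepts UNIV" by (auto simp: partial_concepts_def)
  show "littlestone_dim C = 1"
    using C littlestone_dim_branch_class by (auto simp: branch_family_def)
next
  fix T :: nat and A :: "nat learner"
  assume T: "1 \<le> T" and fin: "makes_finitely_many_queries A branch_family T"
  from ex_hard_sequence[OF fin order_refl] obtain l B
    where l: "length l = T" "distinct (map fst l)"
    and loss: "\<And>p z s. l = p @ z # s \<Longrightarrow> \<exists>N\<le>B. (\<forall>w\<in>set s. N \<le> fst w) \<and>
       round_loss (safe (queries_below N)) A (branch_oracle (p @ [z])) p z [] \<ge> ennreal (1 / 4)"
    by blast
  have "l \<noteq> []" using T l(1) by auto
  note inst = branch_instance[OF fin this l(2,1) order_refl]
  have "ennreal (1 / 4 * real T) = (\<Sum>i<T. ennreal (1 / 4))"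
    by (simp add: ennreal_of_nat_eq_real_of_nat ennreal_mult' mult.commute flip: ennreal_mult)
  also have "\<dots> \<le> (\<Sum>i<length l. round_loss (\<lambda>_. True) A (branch_oracle l) (take i l) (l ! i) [])"
    unfolding l(1)
  proof (rule sum_mono)
    fix i assume "i \<in> {..<T}"
    then have eq: "l = take i l @ l ! i # drop (Suc i) l"
      using l(1) id_take_nth_drop by auto
    from loss[OF eq] obtain N where N: "\<forall>w\<in>set (drop (Suc i) l). N \<le> fst w"
      "round_loss (safe (queries_below N)) A (branch_oracle (take i l @ [l ! i])) (take i l) (l ! i) []
        \<ge> ennreal (1 / 4)"
      by blast
    \<comment> \<open>All points after position \<open>i\<close> are at least \<open>N\<close>, so
      queries below \<open>N\<close> do not see them.\<close>
    have "branch_oracle (take i l @ [l ! i]) S = branch_oracle l S" if "S \<in> queries_below N" for S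
      using branch_oracle_append[of "take i l @ [l ! i]" "drop (Suc i) l" N S] N(1) that eq by simp
    from round_loss_le[OF this] N(2)
    show "ennreal (1 / 4) \<le> round_loss (\<lambda>_. True) A (branch_oracle l) (take i l) (l ! i) []"
      by (rule order_trans[rotated])
  qed
  also have "\<dots> = expected_mistakes A (branch_oracle l) l"
    using nn_integral_mistakes_from inst(2) by (metis expected_mistakes_def mistakes_def)
  also have "\<dots> \<le> worst_case_mistakes A branch_family T"
    unfolding worst_case_mistakes_def using inst(1) by (auto intro: SUP_upper2)
  finally show "ennreal (1 / 4 * real T) \<le> worst_case_mistakes A branch_family T" .
qed

end
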